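(* Let $\bar c_0,c_1,\epsilon_0,\epsilon_1,\mu_1$ be scalars and put $$g_2=\bar c_0\epsilon_1(q^2-q^{-2})q,\quad g_3=\mu_1\bar c_0(q-q^{-1}),\quad g_4=\mu_1\epsilon_0(q-q^{-1}),\quad g_5=-\frac{c_1\bar c_0q(q+q^{-1})}{q-q^{-1}}.$$ Assume $g_3,g_5\neq 0$ and $$\frac{g_2}{g_5}=(q-q^{-1})q^\nu,\qquad \mathfrak a=-\frac{g_3}{g_5}\frac{q^{-3\nu}}{q-q^{-1}},\qquad \mathfrak b=-\frac{g_4}{g_3}(q-q^{-1})q^{-\nu-2},$$ and that $\mathfrak b\ne0$ and $\mathfrak aq^{2m}\neq1$, $\mathfrak bq^{2m}\ne1$ for all integers $m\ge1$. Let $f_s(z)=\left(\frac{\epsilon_0}{\bar c_0}(1-q^2)q^{-\nu-1}z;q^2\right)_s$ (the eigenfunctions of $W_0=\bar c_0S_-q^{s_3}+\epsilon_0q^{2s_3}$). Then for every integer $n\ge0$ $$p_n(z;\mathfrak a,\mathfrak b;q^2)=\sum_{s=0}^{\infty}\gamma_{n,s}f_s(z),$$ where $$\gamma_{n,s}=(-q^2\mathfrak b)^{-n}q^{-n(n-1)}\frac{(q^2\mathfrak b;q^2)_n}{(q^2\mathfrak a;q^2)_n}\,\frac{(q^{-2n};q^2)_s(\mathfrak a\mathfrak b q^{2n+2};q^2)_s}{(q^2\mathfrak b;q^2)_s(q^2;q^2)_s}\,q^{2s}.$$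
   Context: $q\in\mathbb C\setminus\{0\}$ is not a root of unity and $\nu\in\mathbb C$ with $2\nu\notin\mathbb Z_{\ge0}$ (a value of $q^\nu$ is fixed). $q$-shifted factorial: $(a;q)_n=\prod_{k=0}^{n-1}(1-aq^k)$; the sum over $s$ is finite since $(q^{-2n};q^2)_s=0$ for $s>n$. The little $q$-Jacobi polynomials in base $q^2$ are $$p_n(z;\mathfrak a,\mathfrak b;q^2)=\sum_{m=0}^{n}\frac{(q^{-2n};q^2)_m(\mathfrak a\mathfrak b q^{2n+2};q^2)_m}{(q^2\mathfrak a;q^2)_m(q^2;q^2)_m}(q^2z)^m .$$ Here $S_-$ and $q^{s_3}$ are generators of $\mathfrak U_q(sl(2))$ realized on formal power series by $q^{s_3}\mapsto q^{-\nu}T_+$, $S_-\mapsto -z^{-1}\frac{T_--T_+}{q-q^{-1}}$, with $T_\pm f(z)=f(q^{\pm1}z)$. *)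

theory Defs
  imports "HOL-Analysis.Analysis"
begin

definition qpoch :: "complex \<Rightarrow> complex \<Rightarrow> nat \<Rightarrow> complex" where
  "qpoch a q n = (\<Prod>k<n. 1 - a * q ^ k)"

text \<open>Little q-Jacobi polynomials in base \<open>q\<^sup>2\<close>: the argument \<open>q\<close> is the square root of the base.\<close>

definition little_q_jacobi :: "complex \<Rightarrow> nat \<Rightarrow> complex \<Rightarrow> complex \<Rightarrow> complex \<Rightarrow> complex" where
  "little_q_jacobi q n a b z =
     (\<Sum>m\<le>n. qpoch (q powi (- 2 * int n)) (q\<^sup>2) m * qpoch (a * b * q ^ (2 * n + 2)) (q\<^sup>2) m
             / (qpoch (q\<^sup>2 * a) (q\<^sup>2) m * qpoch (q\<^sup>2) (q\<^sup>2) m) * (q\<^sup>2 * z) ^ m)"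

text \<open>A branch of \<open>q\<close> to a complex power is fixed by a logarithm \<open>L\<close> of \<open>q\<close>, i.e. \<open>exp L = q\<close>.\<close>

definition qpw :: "complex \<Rightarrow> complex \<Rightarrow> complex" where
  "qpw L x = exp (x * L)"

text \<open>The substitution \<open>f(z) \<mapsto> f(c z)\<close>; \<open>c = q\<close> and \<open>c = 1 / q\<close> give \<open>T\<^sub>+\<close> and \<open>T\<^sub>-\<close>.\<close>

definition dilate :: "complex \<Rightarrow> complex fps \<Rightarrow> complex fps" where
  "dilate c f = f oo (fps_const c * fps_X)"

definition qs3 :: "complex \<Rightarrow> complex \<Rightarrow> complex \<Rightarrow> complex fps \<Rightarrow> complex fps" where
  "qs3 q L \<nu> f = fps_const (qpw L (- \<nu>)) * dilate q f"

text \<open>The difference has zero constant term, so \<open>fps_shift 1\<close> is multiplication by \<open>z\<close> to the power \<open>-1\<close>.\<close>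

definition S_minus :: "complex \<Rightarrow> complex fps \<Rightarrow> complex fps" where
  "S_minus q f = - fps_shift 1 (fps_const (1 / (q - 1 / q)) * (dilate (1 / q) f - dilate q f))"

definition W0 :: "complex \<Rightarrow> complex \<Rightarrow> complex \<Rightarrow> complex \<Rightarrow> complex \<Rightarrow> complex fps \<Rightarrow> complex fps" where
  "W0 q L \<nu> c0 \<epsilon>0 f = fps_const c0 * S_minus q (qs3 q L \<nu> f) + fps_const \<epsilon>0 * qs3 q L \<nu> (qs3 q L \<nu> f)"

definition is_eigenfunction :: "(complex fps \<Rightarrow> complex fps) \<Rightarrow> complex fps \<Rightarrow> bool" where
  "is_eigenfunction T F \<longleftrightarrow> F \<noteq> 0 \<and> (\<exists>ev. T F = fps_const ev * F)"

definition expansion_coeff :: "complex \<Rightarrow> complex \<Rightarrow> complex \<Rightarrow> nat \<Rightarrow> nat \<Rightarrow> complex" where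
  "expansion_coeff q a b n s =
     (- (q\<^sup>2) * b) powi (- int n) * q powi (- (int n * (int n - 1)))
     * (qpoch (q\<^sup>2 * b) (q\<^sup>2) n / qpoch (q\<^sup>2 * a) (q\<^sup>2) n)
     * (qpoch (q powi (- 2 * int n)) (q\<^sup>2) s * qpoch (a * b * q ^ (2 * n + 2)) (q\<^sup>2) s
        / (qpoch (q\<^sup>2 * b) (q\<^sup>2) s * qpoch (q\<^sup>2) (q\<^sup>2) s))
     * q ^ (2 * s)"

end

theory Submission
  imports Defs
begin

text \<open>
  Put \<open>p = q\<^sup>2\<close> and \<open>\<gamma> = p b\<close>; then the hypotheses give \<open>f s z = (\<gamma> z; p)\<^sub>s\<close>.
  Expanding \<open>(\<gamma> z; p)\<^sub>s\<close> by Gauss's q-binomial theorem and collecting powers of \<open>z\<close>, the coefficient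
  of \<open>z ^ k\<close> becomes a terminating sum evaluated by the q-Chu-Vandermonde formula. The eigenfunction
  property rests on \<open>(x; p)\<^sub>s - (p x; p)\<^sub>s = (p\<^sup>s - 1) x (p x; p)\<^sub>s\<^sub>-\<^sub>1\<close>.
\<close>

section \<open>Splitting and vanishing of q-shifted factorials\<close>

lemma qpoch_0 [simp]: "qpoch a p 0 = 1"
  by (simp add: qpoch_def)

lemma qpoch_Suc: "qpoch a p (Suc n) = qpoch a p n * (1 - a * p ^ n)"
  by (simp add: qpoch_def)

lemma qpoch_add: "qpoch a p (m + n) = qpoch a p m * qpoch (a * p ^ m) p n"
  by (induction n) (simp_all add: qpoch_Suc power_add mult_ac)

lemma qpoch_Suc_shift: "qpoch a p (Suc n) = (1 - a) * qpoch (a * p) p n"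
  using qpoch_add[of a p 1 n] by (simp add: qpoch_Suc)

lemma qpoch_eq_0_iff: "qpoch a p n = 0 \<longleftrightarrow> (\<exists>k<n. a * p ^ k = 1)"
  by (auto simp: qpoch_def)

lemma qpoch_inverse_power_eq_0:
  assumes "p \<noteq> 0" "n < s"
  shows "qpoch (inverse (p ^ n)) p s = 0"
  using assms by (auto simp: qpoch_eq_0_iff intro!: exI[of _ n])

lemma qpoch_self_nonzero:
  assumes "\<And>k. k \<ge> 1 \<Longrightarrow> p ^ k \<noteq> 1"
  shows "qpoch p p n \<noteq> 0"
  using assms[of "Suc _"] by (auto simp: qpoch_eq_0_iff)

section \<open>The two summation formulas: q-Chu-Vandermonde and Gauss\<close>

text \<open>Raising \<open>N\<close> by one changes the sum by a multiple of the same sum with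
  \<open>b\<close> and \<open>c\<close> replaced by \<open>b * p\<close> and \<open>c * p\<close>,
  so the induction keeps both arbitrary. The product on the right is \<open>b ^ N\<close> times the
  factorial of \<open>c / b\<close>, written without division by \<open>b\<close>.\<close>

lemma q_Chu_Vandermonde:
  fixes p b c :: complex
  assumes p: "p \<noteq> 0" "\<And>k. k \<ge> 1 \<Longrightarrow> p ^ k \<noteq> 1" and c: "\<And>k. c * p ^ k \<noteq> 1"
  shows "(\<Sum>s\<le>N. qpoch (inverse (p ^ N)) p s * qpoch b p s / (qpoch c p s * qpoch p p s) * p ^ s)
       = (\<Prod>k<N. b - c * p ^ k) / qpoch c p N"
  using c
proof (induction N arbitrary: b c)
  case 0
  then show ?case by simp
next
  case (Suc N)
  \<comment> \<open>The upper parameter \<open>u\<close> is left free, so that the sums for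
    \<open>N\<close> (\<open>u = i\<close>) and \<open>Suc N\<close> (\<open>u = i / p\<close>) can
    be compared term by term.\<close>
  define t where "t = (\<lambda>u b c s. qpoch u p s * qpoch b p s / (qpoch c p s * qpoch p p s) * p ^ s)"
  define i where "i = inverse (p ^ N)"
  have i: "inverse (p ^ Suc N) = i / p" by (simp add: i_def field_simps)
  have c': "c * p * p ^ k \<noteq> 1" for k using Suc.prems[of "Suc k"] by (simp add: mult_ac)
  have c1: "1 - c \<noteq> 0" using Suc.prems[of 0] by simp
  have cp0: "qpoch (c * p) p s \<noteq> 0" for s using c' by (auto simp: qpoch_eq_0_iff)
  have c0: "qpoch c p s \<noteq> 0" for s using Suc.prems by (auto simp: qpoch_eq_0_iff)
  have pp: "qpoch p p s \<noteq> 0" for s by (rule qpoch_self_nonzero[OF p(2)])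
  have step: "t (i / p) b c (Suc s) - t i b c (Suc s)
      = - i * (1 - b) / (1 - c) * t i (b * p) (c * p) s" for s
  proof -
    have ps: "1 - p * p ^ s \<noteq> 0" using p(2)[of "Suc s"] by simp
    \<comment> \<open>Both factorials contain \<open>qpoch i p s\<close>; the remaining factors
      differ by \<open>(1 - i / p) - (1 - i * p ^ s)\<close>. The resulting
      \<open>1 - p * p ^ s\<close> cancels the last factor of
      \<open>qpoch p p (Suc s)\<close>.\<close>
    have "qpoch (i / p) p (Suc s) - qpoch i p (Suc s) = - qpoch i p s * (i / p) * (1 - p * p ^ s)"
      using p(1) by (simp add: qpoch_Suc_shift[of "i / p"] qpoch_Suc[of i] field_simps)
    moreover have "t (i / p) b c (Suc s) - t i b c (Suc s)
      = (qpoch (i / p) p (Suc s) - qpoch i p (Suc s))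
        * (qpoch b p (Suc s) / (qpoch c p (Suc s) * qpoch p p (Suc s)) * p ^ Suc s)"
      by (simp add: t_def left_diff_distrib diff_divide_distrib mult.assoc)
    ultimately show ?thesis
      using ps c1 cp0[of s] pp[of s] p(1)
      by (simp add: t_def qpoch_Suc_shift[of b] qpoch_Suc_shift[of c] qpoch_Suc[of p])
  qed
  have "(\<Sum>s\<le>Suc N. t (i / p) b c s) - (\<Sum>s\<le>Suc N. t i b c s)
      = (\<Sum>s\<le>Suc N. t (i / p) b c s - t i b c s)"
    by (simp only: sum_subtractf)
  \<comment> \<open>The terms at index 0 are both 1 and cancel, which shifts the index down by
    one.\<close>
  also have "\<dots> = (\<Sum>s\<le>N. - i * (1 - b) / (1 - c) * t i (b * p) (c * p) s)"
    unfolding sum.atMost_Suc_shift step by (simp add: t_def)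
  also have "\<dots> = - i * (1 - b) / (1 - c) * ((\<Prod>k<N. b * p - c * p * p ^ k) / qpoch (c * p) p N)"
    unfolding sum_distrib_left[symmetric]
    using Suc.IH[of "c * p" "b * p", OF c'] by (simp only: t_def i_def)
  also have "(\<Prod>k<N. b * p - c * p * p ^ k) = p ^ N * (\<Prod>k<N. b - c * p ^ k)"
    by (induction N) (simp_all add: algebra_simps)
  also have "- i * (1 - b) / (1 - c) * (p ^ N * (\<Prod>k<N. b - c * p ^ k) / qpoch (c * p) p N)
      = - ((1 - b) * (\<Prod>k<N. b - c * p ^ k) / qpoch c p (Suc N))"
    using p(1) c1 cp0[of N] by (simp add: i_def qpoch_Suc_shift field_simps)
  finally have diff: "(\<Sum>s\<le>Suc N. t (i / p) b c s) - (\<Sum>s\<le>Suc N. t i b c s)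
      = - ((1 - b) * (\<Prod>k<N. b - c * p ^ k) / qpoch c p (Suc N))" .
  \<comment> \<open>The series with parameter \<open>i\<close> already stops at \<open>N\<close>, so
    its sum up to \<open>Suc N\<close> is given by the induction hypothesis.\<close>
  have "t i b c (Suc N) = 0"
    using qpoch_inverse_power_eq_0[OF p(1), of N "Suc N"] by (simp add: t_def i_def)
  then have "(\<Sum>s\<le>Suc N. t i b c s) = (\<Prod>k<N. b - c * p ^ k) / qpoch c p N"
    using Suc.IH[of c b] Suc.prems by (simp add: t_def i_def)
  then have "(\<Sum>s\<le>Suc N. t (i / p) b c s)
      = (\<Prod>k<N. b - c * p ^ k) / qpoch c p N - (1 - b) * (\<Prod>k<N. b - c * p ^ k) / qpoch c p (Suc N)"
    using diff unfolding diff_eq_eq by (simp del: sum.atMost_Suc)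
  \<comment> \<open>Over the common denominator the new factor is
    \<open>(1 - c * p ^ N) - (1 - b) = b - c * p ^ N\<close>.\<close>
  also have "\<dots> = (\<Prod>k<Suc N. b - c * p ^ k) / qpoch c p (Suc N)"
    using c0[of N] Suc.prems[of N] by (simp add: qpoch_Suc) (simp add: divide_simps algebra_simps)
  finally show ?case unfolding i t_def .
qed

text \<open>Gauss's formula, divided by \<open>qpoch p p s\<close> so that no q-binomial coefficient
  has to be introduced. Both sides, as functions A of \<open>s\<close> and \<open>x\<close>, satisfy
  \<open>(1 - p ^ Suc s) * A (Suc s) x = (1 - x) * A s (x * p)\<close>.\<close>

lemma qpoch_binomial:
  fixes p x :: complex
  assumes p: "\<And>k. k \<ge> 1 \<Longrightarrow> p ^ k \<noteq> 1"
  shows "qpoch x p s / qpoch p p s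
       = (\<Sum>k\<le>s. (- x) ^ k * p ^ (k choose 2) / (qpoch p p k * qpoch p p (s - k)))"
proof (induction s arbitrary: x)
  case 0
  then show ?case by (simp add: numeral_2_eq_2)
next
  case (Suc s)
  have pp: "qpoch p p s \<noteq> 0" for s by (rule qpoch_self_nonzero[OF p])
  have pS: "1 - p * p ^ k \<noteq> 0" for k using p[of "Suc k"] by simp
  define h where "h = (\<lambda>k. (- x) ^ k * p ^ (k choose 2) / qpoch p p k)"
  have h_Suc: "h (Suc k) * (1 - p * p ^ k) = - x * p ^ k * h k" for k
    using pS[of k] pp[of k]
    by (simp add: h_def qpoch_Suc numeral_2_eq_2 power_add divide_simps)
  define r where "r = (\<lambda>k. inverse (qpoch p p k))"
  have r_Suc: "r k = r (Suc k) * (1 - p * p ^ k)" for k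
    using pS[of k] pp[of k] by (simp add: r_def qpoch_Suc)
  have pow: "(- (x * p)) ^ k = (- x) ^ k * p ^ k" for k
    by (simp only: mult_minus_left[symmetric] power_mult_distrib)
  \<comment> \<open>The split
    \<open>1 - p ^ Suc s = (1 - p ^ (Suc s - k)) * p ^ k + (1 - p ^ k)\<close> gives each factorial
    in the denominator a factor that lowers its index.\<close>
  have "(1 - p * p ^ s) * (\<Sum>k\<le>Suc s. h k * r (Suc s - k))
      = (\<Sum>k\<le>Suc s. h k * (r (Suc s - k) * (1 - p ^ (Suc s - k))) * p ^ k + h k * (1 - p ^ k) * r (Suc s - k))"
    unfolding sum_distrib_left
  proof (rule sum.cong)
    fix k assume "k \<in> {..Suc s}"
    then have "p * p ^ s = p ^ k * p ^ (Suc s - k)"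
      by (simp flip: power_add power_Suc)
    then show "(1 - p * p ^ s) * (h k * r (Suc s - k))
      = h k * (r (Suc s - k) * (1 - p ^ (Suc s - k))) * p ^ k + h k * (1 - p ^ k) * r (Suc s - k)"
      by (simp add: algebra_simps)
  qed simp
  \<comment> \<open>The first part vanishes at \<open>k = Suc s\<close>, the second at
    \<open>k = 0\<close>; after reindexing the second, both run over \<open>k \<le> s\<close> and
    combine into the factor \<open>1 - x\<close>.\<close>
  also have "\<dots> = (\<Sum>k\<le>s. h k * r (s - k) * p ^ k) + (\<Sum>k\<le>s. - x * p ^ k * h k * r (s - k))"
  proof -
    have "(\<Sum>k\<le>Suc s. h k * (r (Suc s - k) * (1 - p ^ (Suc s - k))) * p ^ k) = (\<Sum>k\<le>s. h k * r (s - k) * p ^ k)"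
    proof -
      have "r (Suc s - k) * (1 - p ^ (Suc s - k)) = r (s - k)" if "k \<le> s" for k
        using r_Suc[of "s - k"] that by (simp add: Suc_diff_le)
      then show ?thesis by (simp cong: sum.cong_simp)
    qed
    moreover have "(\<Sum>k\<le>Suc s. h k * (1 - p ^ k) * r (Suc s - k)) = (\<Sum>k\<le>s. - x * p ^ k * h k * r (s - k))"
      unfolding sum.atMost_Suc_shift by (simp add: h_Suc)
    ultimately show ?thesis by (simp add: sum.distrib)
  qed
  also have "\<dots> = (1 - x) * (\<Sum>k\<le>s. (- (x * p)) ^ k * p ^ (k choose 2) / (qpoch p p k * qpoch p p (s - k)))"
    unfolding sum_distrib_left sum.distrib[symmetric] pow
    by (intro sum.cong refl)
       (simp add: h_def r_def divide_inverse algebra_simps)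
  also have "\<dots> = (1 - x) * (qpoch (x * p) p s / qpoch p p s)"
    by (simp add: Suc)
  also have "\<dots> = (1 - p * p ^ s) * (qpoch x p (Suc s) / qpoch p p (Suc s))"
    using pS[of s] by (simp add: qpoch_Suc_shift[of x] qpoch_Suc[of p])
  finally have "qpoch x p (Suc s) / qpoch p p (Suc s) = (\<Sum>k\<le>Suc s. h k * r (Suc s - k))"
    using pS[of s] by (simp only: mult_cancel_left) simp
  then show ?case by (simp add: h_def r_def divide_inverse mult_ac)
qed

section \<open>The connection formula in base \<open>p\<close>\<close>

lemma choose_two_add: "(m + n) choose 2 = (m choose 2) + (n choose 2) + m * n"
  by (induction n) (simp_all add: numeral_2_eq_2)

text \<open>Here \<open>c\<close> stands for \<open>p * b\<close>. Once Gauss's formula is inserted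
  and the sums are exchanged, the coefficient of \<open>z ^ k\<close> is a q-Chu-Vandermonde sum of
  length \<open>n - k\<close> with parameters \<open>\<alpha> * p ^ k\<close> and
  \<open>c * p ^ k\<close>.\<close>

lemma little_q_Jacobi_connection:
  fixes p a c z :: complex
  assumes p: "p \<noteq> 0" "\<And>k. k \<ge> 1 \<Longrightarrow> p ^ k \<noteq> 1"
    and c: "c \<noteq> 0" "\<And>k. c * p ^ k \<noteq> 1" and a: "\<And>k. p * a * p ^ k \<noteq> 1"
    and \<alpha>: "\<alpha> = c * a * p ^ n"
  shows "(\<Sum>s\<le>n. qpoch (inverse (p ^ n)) p s * qpoch \<alpha> p s * qpoch (c * z) p s
            / (qpoch c p s * qpoch p p s) * p ^ s)
       = (- c) ^ n * p ^ (n choose 2) * qpoch (p * a) p n / qpoch c p n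
         * (\<Sum>m\<le>n. qpoch (inverse (p ^ n)) p m * qpoch \<alpha> p m / (qpoch (p * a) p m * qpoch p p m) * (p * z) ^ m)"
proof -
  have pp: "qpoch p p s \<noteq> 0" for s by (rule qpoch_self_nonzero[OF p(2)])
  have cc: "qpoch c p s \<noteq> 0" for s using c(2) by (auto simp: qpoch_eq_0_iff)
  have aa: "qpoch (p * a) p s \<noteq> 0" for s using a by (auto simp: qpoch_eq_0_iff)
  define w where "w = (\<lambda>s. qpoch (inverse (p ^ n)) p s * qpoch \<alpha> p s / qpoch c p s * p ^ s)"
  define h where "h = (\<lambda>k. (- (c * z)) ^ k * p ^ (k choose 2) / qpoch p p k)"
  have inner: "(\<Sum>j\<le>n - k. w (k + j) / qpoch p p j)
      = w k * ((\<Prod>j<n - k. \<alpha> * p ^ k - c * p ^ k * p ^ j) / qpoch (c * p ^ k) p (n - k))"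
    if k: "k \<le> n" for k
  proof -
    \<comment> \<open>Splitting the factorials at \<open>k\<close> shifts the terminating parameter
      to the one that belongs to \<open>n - k\<close>.\<close>
    have "inverse (p ^ n) * p ^ k = inverse (p ^ (n - k))"
      using p(1) k by (simp add: power_diff divide_inverse mult.commute)
    then have "w (k + j) / qpoch p p j = w k * (qpoch (inverse (p ^ (n - k))) p j * qpoch (\<alpha> * p ^ k) p j
        / (qpoch (c * p ^ k) p j * qpoch p p j) * p ^ j)" for j
      by (simp add: w_def qpoch_add power_add mult_ac)
    moreover
    have "c * p ^ k * p ^ i \<noteq> 1" for i
      using c(2)[of "k + i"] by (simp add: power_add mult_ac)
    note q_Chu_Vandermonde[OF p this, of "n - k" "\<alpha> * p ^ k"]
    ultimately show ?thesis
      by (simp only: sum_distrib_left[symmetric])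
  qed
  have "(\<Prod>j<n - k. \<alpha> * p ^ k - c * p ^ k * p ^ j) * ((- c) ^ k * p ^ (k choose 2)) * qpoch (p * a) p k
      = (- c) ^ n * p ^ (n choose 2) * qpoch (p * a) p n" if "k \<le> n" for k
  proof -
    obtain m where n: "n = k + m" using le_Suc_ex[OF \<open>k \<le> n\<close>] by blast
    \<comment> \<open>By the choice of \<open>\<alpha>\<close>, the factor equals
      \<open>- c * p ^ (k + j) * (1 - a * p ^ (n - j))\<close>, and
      \<open>n - j = 1 + k + (m - Suc j)\<close>. Reversing the order of \<open>j\<close> turns the
      last factors into a q-shifted factorial.\<close>
    have "(\<Prod>j<m. \<alpha> * p ^ k - c * p ^ k * p ^ j)
        = (\<Prod>j<m. - c * p ^ k * p ^ j * (1 - p * a * p ^ k * p ^ (m - Suc j)))"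
    proof (rule prod.cong)
      fix j assume "j \<in> {..<m}"
      then obtain l where "m = Suc (j + l)" using less_imp_Suc_add[of j m] by auto
      then show "\<alpha> * p ^ k - c * p ^ k * p ^ j = - c * p ^ k * p ^ j * (1 - p * a * p ^ k * p ^ (m - Suc j))"
        by (simp add: \<alpha> n power_add algebra_simps)
    qed simp
    also have "\<dots> = (\<Prod>j<m. - c * p ^ k) * (\<Prod>j<m. p ^ j) * (\<Prod>j<m. 1 - p * a * p ^ k * p ^ (m - Suc j))"
      by (simp only: prod.distrib)
    also have "(\<Prod>j<m. 1 - p * a * p ^ k * p ^ (m - Suc j)) = qpoch (p * a * p ^ k) p m"
      unfolding qpoch_def by (rule prod.nat_diff_reindex)
    also have "(\<Prod>j<m. p ^ j) = p ^ (m choose 2)"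
      by (induction m) (simp_all add: numeral_2_eq_2 power_add)
    finally have "(\<Prod>j<m. \<alpha> * p ^ k - c * p ^ k * p ^ j)
        = (- c * p ^ k) ^ m * p ^ (m choose 2) * qpoch (p * a * p ^ k) p m"
      by simp
    moreover have "(- c * p ^ k) ^ m = (- c) ^ m * p ^ (k * m)"
      by (simp only: power_mult_distrib power_mult)
    ultimately show ?thesis
      by (simp add: n choose_two_add qpoch_add power_add mult_ac)
  qed
  then have prod: "(\<Prod>j<n - k. \<alpha> * p ^ k - c * p ^ k * p ^ j) * ((- c) ^ k * p ^ (k choose 2))
      = (- c) ^ n * p ^ (n choose 2) * qpoch (p * a) p n / qpoch (p * a) p k" if "k \<le> n" for k
    using that aa[of k] by (simp only: eq_divide_eq if_True not_False_eq_True)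
  have "(\<Sum>s\<le>n. qpoch (inverse (p ^ n)) p s * qpoch \<alpha> p s * qpoch (c * z) p s
            / (qpoch c p s * qpoch p p s) * p ^ s)
      = (\<Sum>s\<le>n. w s * (qpoch (c * z) p s / qpoch p p s))"
    by (simp add: w_def mult_ac)
  \<comment> \<open>Writing \<open>s\<close> as \<open>k + (s - k)\<close> makes the summand a
    function of \<open>k\<close> and \<open>j = s - k\<close>, as the triangular reindexing
    requires.\<close>
  also have "\<dots> = (\<Sum>s\<le>n. \<Sum>k\<le>s. h k * (w (k + (s - k)) / qpoch p p (s - k)))"
  proof (rule sum.cong)
    fix s
    have "qpoch (c * z) p s / qpoch p p s
        = (\<Sum>k\<le>s. (- (c * z)) ^ k * p ^ (k choose 2) / (qpoch p p k * qpoch p p (s - k)))"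
      by (rule qpoch_binomial) (rule p(2))
    then have "w s * (qpoch (c * z) p s / qpoch p p s)
        = (\<Sum>k\<le>s. w s * ((- (c * z)) ^ k * p ^ (k choose 2) / (qpoch p p k * qpoch p p (s - k))))"
      by (simp only: sum_distrib_left)
    also have "\<dots> = (\<Sum>k\<le>s. h k * (w (k + (s - k)) / qpoch p p (s - k)))"
      by (intro sum.cong refl) (simp add: h_def mult_ac)
    finally show "w s * (qpoch (c * z) p s / qpoch p p s) = \<dots>" .
  qed simp
  also have "\<dots> = (\<Sum>(k, j)\<in>{(k, j). k + j \<le> n}. h k * (w (k + j) / qpoch p p j))"
    by (simp only: sum.triangle_reindex_eq)
  also have "{(k, j). k + j \<le> n} = Sigma {..n} (\<lambda>k. {..n - k})"
    by auto
  also have "(\<Sum>(k, j)\<in>\<dots>. h k * (w (k + j) / qpoch p p j))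
      = (\<Sum>k\<le>n. h k * (\<Sum>j\<le>n - k. w (k + j) / qpoch p p j))"
    by (simp add: sum.Sigma[symmetric] sum_distrib_left)
  also have "\<dots> = (\<Sum>k\<le>n. (- c) ^ n * p ^ (n choose 2) * qpoch (p * a) p n / qpoch c p n
      * (qpoch (inverse (p ^ n)) p k * qpoch \<alpha> p k / (qpoch (p * a) p k * qpoch p p k) * (p * z) ^ k))"
  proof (rule sum.cong)
    fix k assume "k \<in> {..n}"
    then have k: "k \<le> n" by simp
    \<comment> \<open>The denominators from \<open>w k\<close> and from the inner sum combine into
      \<open>qpoch c p n\<close>, which does not depend on \<open>k\<close>.\<close>
    have cn: "qpoch c p n = qpoch c p k * qpoch (c * p ^ k) p (n - k)"
      using qpoch_add[of c p k "n - k"] k by simp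
    have "h k = (- c) ^ k * p ^ (k choose 2) * z ^ k / qpoch p p k"
      unfolding h_def mult_minus_left[symmetric] power_mult_distrib by (simp add: mult_ac)
    then have "h k * (\<Sum>j\<le>n - k. w (k + j) / qpoch p p j)
      = (\<Prod>j<n - k. \<alpha> * p ^ k - c * p ^ k * p ^ j) * ((- c) ^ k * p ^ (k choose 2))
        * (z ^ k / qpoch p p k * w k / qpoch (c * p ^ k) p (n - k))"
      by (simp add: inner[OF k])
    also have "\<dots> = (- c) ^ n * p ^ (n choose 2) * qpoch (p * a) p n / qpoch c p n
      * (qpoch (inverse (p ^ n)) p k * qpoch \<alpha> p k / (qpoch (p * a) p k * qpoch p p k) * (p * z) ^ k)"
      unfolding prod[OF k] cn by (simp add: w_def power_mult_distrib mult_ac)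
    finally show "h k * (\<Sum>j\<le>n - k. w (k + j) / qpoch p p j) = \<dots>" .
  qed simp
  finally show ?thesis by (simp add: sum_distrib_left)
qed

section \<open>Dilations of power series and eigenfunctions of \<open>W0\<close>\<close>

lemma dilate_mult: "dilate c (f * g) = dilate c f * dilate c g"
  by (simp add: dilate_def fps_compose_mult_distrib)

lemma dilate_const [simp]: "dilate c (fps_const k) = fps_const k"
  by (simp add: dilate_def)

lemma dilate_dilate: "dilate c (dilate d f) = dilate (c * d) f"
  by (rule fps_ext) (simp add: dilate_def fps_compose_linear power_mult_distrib)

lemma dilate_1 [simp]: "dilate 1 f = f"
  by (simp add: dilate_def)

text \<open>The formal-series counterpart of the function
  \<open>\<lambda>z. qpoch (c * z) p s\<close>, since \<open>W0\<close> acts on formal power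
  series.\<close>

definition fps_qpoch :: "complex \<Rightarrow> complex \<Rightarrow> nat \<Rightarrow> complex fps" where
  "fps_qpoch c p s = (\<Prod>k<s. 1 - fps_const (c * p ^ k) * fps_X)"

lemma fps_qpoch_Suc: "fps_qpoch c p (Suc s) = fps_qpoch c p s * (1 - fps_const (c * p ^ s) * fps_X)"
  by (simp add: fps_qpoch_def)

lemma fps_qpoch_Suc_shift:
  "fps_qpoch c p (Suc s) = (1 - fps_const c * fps_X) * fps_qpoch (c * p) p s"
  by (simp add: fps_qpoch_def prod.lessThan_Suc_shift mult_ac del: prod.lessThan_Suc)

lemma has_fps_expansion_qpoch: "(\<lambda>z. qpoch (c * z) p s) has_fps_expansion fps_qpoch c p s"
proof (induction s)
  case 0
  then show ?case by (simp add: fps_qpoch_def)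
next
  case (Suc s)
  have "(\<lambda>z. qpoch (c * z) p s * (1 - c * p ^ s * z)) has_fps_expansion
      fps_qpoch c p s * (1 - fps_const (c * p ^ s) * fps_X)"
    by (intro fps_expansion_intros Suc)
  then show ?case by (simp add: qpoch_Suc fps_qpoch_Suc mult_ac)
qed

lemma fps_qpoch_nonzero: "fps_qpoch c p s \<noteq> 0"
proof
  assume "fps_qpoch c p s = 0"
  moreover have "fps_nth (fps_qpoch c p s) 0 = 1"
    by (induction s) (simp_all add: fps_qpoch_def)
  ultimately show False by simp
qed

lemma dilate_fps_qpoch: "dilate d (fps_qpoch c p s) = fps_qpoch (c * d) p s"
proof (induction s)
  case 0
  then show ?case by (simp add: fps_qpoch_def dilate_def)
next
  case (Suc s)
  have "dilate d (1 - fps_const (c * p ^ s) * fps_X) = 1 - fps_const (c * d * p ^ s) * fps_X"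
    by (simp add: dilate_def fps_compose_sub_distrib fps_compose_mult_distrib mult_ac flip: fps_const_mult)
  then show ?case by (simp add: fps_qpoch_Suc dilate_mult Suc)
qed

text \<open>\<open>F\<close> and its dilation by \<open>q\<^sup>2\<close> share all but one linear
  factor, so their difference is a multiple of \<open>z\<close> times the common part
  \<open>G\<close>. The value of \<open>c\<close> is the one for which the two summands of
  \<open>W0\<close> add up to a multiple of \<open>(1 - c * z) * G\<close>.\<close>

lemma W0_fps_qpoch:
  assumes q: "q \<noteq> 0" "q - 1 / q \<noteq> 0" and c0: "c0 \<noteq> 0"
    and c: "c = - (\<epsilon>0 / c0) * (q - 1 / q) * qpw L (- \<nu>)"
  shows "W0 q L \<nu> c0 \<epsilon>0 (fps_qpoch c (q\<^sup>2) s)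
       = fps_const (\<epsilon>0 * (qpw L (- \<nu>))\<^sup>2 * q ^ (2 * s)) * fps_qpoch c (q\<^sup>2) s"
proof -
  define p where "p = q\<^sup>2"
  define k where "k = qpw L (- \<nu>)"
  define d where "d = q - 1 / q"
  define F where "F = fps_qpoch c p s"
  have dF: "dilate q (dilate q F) = fps_qpoch (c * p) p s"
    by (simp add: F_def dilate_dilate dilate_fps_qpoch p_def power2_eq_square mult.assoc)
  have inv: "dilate (1 / q) (dilate q F) = F"
    using q(1) by (simp add: dilate_dilate)
  have W0: "W0 q L \<nu> c0 \<epsilon>0 F
      = - (fps_const c0 * fps_shift 1 (fps_const (k / d) * (F - fps_qpoch (c * p) p s)))
        + fps_const (\<epsilon>0 * k\<^sup>2) * fps_qpoch (c * p) p s"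
    by (simp add: W0_def S_minus_def d_def qs3_def k_def dF inv dilate_mult right_diff_distrib
        power2_eq_square mult.assoc[symmetric])
  show ?thesis
  proof (cases s)
    \<comment> \<open>Here the series is 1 and the difference operator kills it; \<open>G\<close>
      exists only for positive \<open>s\<close>.\<close>
    case 0
    then show ?thesis using W0 by (simp add: F_def p_def k_def fps_qpoch_def)
  next
    case (Suc r)
    define G where "G = fps_qpoch (c * p) p r"
    have F: "F = (1 - fps_const c * fps_X) * G"
      by (simp add: F_def G_def Suc fps_qpoch_Suc_shift)
    have H: "fps_qpoch (c * p) p s = (1 - fps_const (c * p ^ s) * fps_X) * G"
      by (simp add: G_def Suc fps_qpoch_Suc mult_ac)
    have "fps_const (k / d) * (F - fps_qpoch (c * p) p s)
        = fps_const (k / d * c * (p ^ s - 1)) * G * fps_X"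
    proof -
      have "F - fps_qpoch (c * p) p s = fps_const (c * (p ^ s - 1)) * G * fps_X"
        unfolding F H by (simp add: algebra_simps flip: fps_const_mult fps_const_sub)
      then show ?thesis by (simp add: mult.assoc[symmetric])
    qed
    then have "fps_shift 1 (fps_const (k / d) * (F - fps_qpoch (c * p) p s))
        = fps_const (k / d * c * (p ^ s - 1)) * G"
      by (simp only: fps_shift_times_fps_X')
    then have "W0 q L \<nu> c0 \<epsilon>0 F
      = fps_const (- c0 * (k / d * c * (p ^ s - 1))) * G
        + fps_const (\<epsilon>0 * k\<^sup>2) * ((1 - fps_const (c * p ^ s) * fps_X) * G)"
      unfolding W0 H[symmetric] by (simp only: fps_const_mult fps_const_neg flip: mult.assoc mult_minus_left)
    \<comment> \<open>This is where the value of \<open>c\<close> enters: it gives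
      \<open>k / d * c = - \<epsilon>0 * k\<^sup>2 / c0\<close>.\<close>
    also have "- c0 * (k / d * c * (p ^ s - 1)) = \<epsilon>0 * k\<^sup>2 * (p ^ s - 1)"
      using q(2) c0 by (simp add: c d_def[symmetric] k_def[symmetric] power2_eq_square)
    also have "fps_const (\<epsilon>0 * k\<^sup>2 * (p ^ s - 1)) * G
        + fps_const (\<epsilon>0 * k\<^sup>2) * ((1 - fps_const (c * p ^ s) * fps_X) * G)
        = fps_const (\<epsilon>0 * k\<^sup>2 * p ^ s) * F"
      unfolding F by (simp add: algebra_simps flip: fps_const_mult fps_const_sub)
    finally show ?thesis by (simp add: F_def p_def k_def power_mult)
  qed
qed

section \<open>Matching the parameters and summing the expansion\<close>

theorem proposition3p2:
  fixes q L \<nu> c0 c1 \<epsilon>0 \<epsilon>1 \<mu>1 g2 g3 g4 g5 a b :: complex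
    and f :: "nat \<Rightarrow> complex \<Rightarrow> complex"
  assumes q_nonzero: "q \<noteq> 0"
    and q_not_root_of_unity: "\<forall>k::nat. k \<ge> 1 \<longrightarrow> q ^ k \<noteq> 1"
    and L: "exp L = q"
    and \<nu>: "\<forall>k::nat. 2 * \<nu> \<noteq> of_nat k"
    and g2: "g2 = c0 * \<epsilon>1 * (q\<^sup>2 - 1 / q\<^sup>2) * q"
    and g3: "g3 = \<mu>1 * c0 * (q - 1 / q)"
    and g4: "g4 = \<mu>1 * \<epsilon>0 * (q - 1 / q)"
    and g5: "g5 = - (c1 * c0 * q * (q + 1 / q) / (q - 1 / q))"
    and g3_nonzero: "g3 \<noteq> 0"
    and g5_nonzero: "g5 \<noteq> 0"
    and g2_g5: "g2 / g5 = (q - 1 / q) * qpw L \<nu>"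
    and a: "a = - (g3 / g5) * (qpw L (- 3 * \<nu>) / (q - 1 / q))"
    and b: "b = - (g4 / g3) * (q - 1 / q) * qpw L (- \<nu> - 2)"
    and b_nonzero: "b \<noteq> 0"
    and a_generic: "\<forall>m::nat. m \<ge> 1 \<longrightarrow> a * q ^ (2 * m) \<noteq> 1"
    and b_generic: "\<forall>m::nat. m \<ge> 1 \<longrightarrow> b * q ^ (2 * m) \<noteq> 1"
    and f: "\<forall>s z. f s z = qpoch (\<epsilon>0 / c0 * (1 - q\<^sup>2) * qpw L (- \<nu> - 1) * z) (q\<^sup>2) s"
  shows "(\<forall>s. \<exists>F. f s has_fps_expansion F \<and> is_eigenfunction (W0 q L \<nu> c0 \<epsilon>0) F)
       \<and> (\<forall>n z. (\<lambda>s. expansion_coeff q a b n s * f s z) sums little_q_jacobi q n a b z)"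
proof -
  define p where "p = q\<^sup>2"
  define c where "c = p * b"
  have p0: "p \<noteq> 0" using q_nonzero by (simp add: p_def)
  have p1: "p ^ k \<noteq> 1" if "k \<ge> 1" for k
    using q_not_root_of_unity[rule_format, of "2 * k"] that by (simp add: p_def power_mult)
  have c0: "c0 \<noteq> 0" and m1: "\<mu>1 \<noteq> 0" and d: "q - 1 / q \<noteq> 0"
    using g3 g3_nonzero by auto
  have "qpw L (- \<nu> - 2) = qpw L (- \<nu>) / q\<^sup>2"
    by (simp add: qpw_def left_diff_distrib exp_diff mult_exp_exp exp_double L)
  \<comment> \<open>The factor \<open>\<mu>1 * (q - 1 / q)\<close> cancels, so \<open>p * b\<close>
    has exactly the form of \<open>c\<close> required by \<open>W0_fps_qpoch\<close>.\<close>
  moreover have "g4 / g3 = \<epsilon>0 / c0"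
    using c0 m1 d by (simp add: g3 g4)
  ultimately have c: "c = - (\<epsilon>0 / c0) * (q - 1 / q) * qpw L (- \<nu>)"
    using q_nonzero by (simp add: c_def b p_def)
  \<comment> \<open>Since \<open>(1 - q\<^sup>2) / q = - (q - 1 / q)\<close>, the coefficient of
    \<open>z\<close> in \<open>f\<close> is \<open>c\<close> as well.\<close>
  have "(1 - q\<^sup>2) * qpw L (- \<nu> - 1) = - ((q - 1 / q) * qpw L (- \<nu>))"
    using q_nonzero
    by (simp add: qpw_def left_diff_distrib exp_diff L field_simps power2_eq_square)
  then have "\<epsilon>0 / c0 * (1 - q\<^sup>2) * qpw L (- \<nu> - 1) = c"
    by (simp add: c mult.assoc)
  then have f': "f s = (\<lambda>z. qpoch (c * z) p s)" for s
    using f by (auto simp: p_def)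
  have eigen: "\<exists>F. f s has_fps_expansion F \<and> is_eigenfunction (W0 q L \<nu> c0 \<epsilon>0) F" for s
    using has_fps_expansion_qpoch[of c p s] fps_qpoch_nonzero[of c p s]
      W0_fps_qpoch[OF q_nonzero d c0 c, of s]
    unfolding f' is_eigenfunction_def p_def by blast
  \<comment> \<open>The index \<open>Suc k\<close> accounts for the extra factor \<open>p\<close> in
    \<open>c = p * b\<close>.\<close>
  have cp: "c * p ^ k \<noteq> 1" for k
    using b_generic[rule_format, of "Suc k"] unfolding power_mult by (simp add: c_def p_def mult_ac)
  have ap: "p * a * p ^ k \<noteq> 1" for k
    using a_generic[rule_format, of "Suc k"] unfolding power_mult by (simp add: p_def mult_ac)
  have cn0: "c \<noteq> 0" using p0 b_nonzero by (simp add: c_def)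
  have "(\<lambda>s. expansion_coeff q a b n s * f s z) sums little_q_jacobi q n a b z" for n z
  proof -
    define \<alpha> where "\<alpha> = a * b * q ^ (2 * n + 2)"
    have \<alpha>: "\<alpha> = c * a * p ^ n"
      unfolding \<alpha>_def c_def p_def power_add power_mult by (simp add: mult_ac)
    have i: "q powi (- 2 * int n) = inverse (p ^ n)"
    proof -
      have "- 2 * int n = - int (2 * n)" by simp
      then show ?thesis by (simp only: power_int_minus power_int_of_nat p_def power_mult)
    qed
    have "int n * (int n - 1) = int (2 * (n choose 2))"
      by (induction n) (simp_all add: numeral_2_eq_2 algebra_simps)
    then have e: "q powi (- (int n * (int n - 1))) = inverse (p ^ (n choose 2))"
      by (simp only: power_int_minus power_int_of_nat p_def power_mult)
    \<comment> \<open>The part of the coefficient that does not depend on \<open>s\<close>; it is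
      the reciprocal of the constant in \<open>little_q_Jacobi_connection\<close>.\<close>
    define K where "K = inverse ((- c) ^ n) * inverse (p ^ (n choose 2)) * (qpoch c p n / qpoch (p * a) p n)"
    have coeff: "expansion_coeff q a b n s * f s z = K * (qpoch (inverse (p ^ n)) p s * qpoch \<alpha> p s
        * qpoch (c * z) p s / (qpoch c p s * qpoch p p s) * p ^ s)" for s
      unfolding expansion_coeff_def i e \<alpha>_def[symmetric]
      by (simp add: K_def f' c_def p_def power_int_minus power_mult)
    have "expansion_coeff q a b n s * f s z = 0" if "s \<notin> {..n}" for s
      using that by (simp add: coeff qpoch_inverse_power_eq_0[OF p0])
    then have "(\<lambda>s. expansion_coeff q a b n s * f s z) sums (\<Sum>s\<le>n. expansion_coeff q a b n s * f s z)"
      by (intro sums_finite) auto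
    also have "(\<Sum>s\<le>n. expansion_coeff q a b n s * f s z) = little_q_jacobi q n a b z"
    proof -
      have "qpoch c p n \<noteq> 0" "qpoch (p * a) p n \<noteq> 0"
        using cp ap by (auto simp: qpoch_eq_0_iff)
      then have K: "K * ((- c) ^ n * p ^ (n choose 2) * qpoch (p * a) p n / qpoch c p n) = 1"
        using cn0 p0 by (simp add: K_def field_simps)
      have J: "little_q_jacobi q n a b z = (\<Sum>m\<le>n. qpoch (inverse (p ^ n)) p m * qpoch \<alpha> p m
          / (qpoch (p * a) p m * qpoch p p m) * (p * z) ^ m)"
        unfolding little_q_jacobi_def i \<alpha>_def p_def ..
      have "(\<Sum>s\<le>n. expansion_coeff q a b n s * f s z)
          = K * (\<Sum>s\<le>n. qpoch (inverse (p ^ n)) p s * qpoch \<alpha> p s * qpoch (c * z) p s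
            / (qpoch c p s * qpoch p p s) * p ^ s)"
        by (simp only: coeff sum_distrib_left)
      also have "\<dots> = K * ((- c) ^ n * p ^ (n choose 2) * qpoch (p * a) p n / qpoch c p n) * little_q_jacobi q n a b z"
        using little_q_Jacobi_connection[OF p0 p1 cn0 cp ap \<alpha>, of z] by (simp only: J mult.assoc)
      finally show ?thesis by (simp only: K mult_1_left)
    qed
    finally show ?thesis .
  qed
  then show ?thesis using eigen by blast
qed

end
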